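(* Let $H$ be a connected graph with at least three nodes and let $r_H = \widetilde{\operatorname{diam}}(H) - 1$. For every integer $T < r_H$, there exists no $T$-round algorithm for $\textsc{MemList}(H)$ or for $\textsc{MemDetect}(H)$ under node insertions.
   Context: For nodes $u,v$ of a graph $G$, $\operatorname{dist}_G(u,v)$ is the shortest-path distance. The node-edge distance between a node $u$ and an edge $e=\{v,w\}$ is $\operatorname{dist}_G(u,e) = 1 + \min\{\operatorname{dist}_G(u,v), \operatorname{dist}_G(u,w)\}$, and $\widetilde{\operatorname{diam}}(G) = \max_{u \in V(G)} \max_{e \in E(G)} \operatorname{dist}_G(u,e)$. Dynamic network model: a sequence of graphs $G^0, G^1, \ldots$, each obtained from the previous by at most one node insertion (a new node adjacent to an arbitrary subset of existing nodes); nodes have distinct IDs, know their neighbors' IDs and initially the whole of $G^0$; communication is synchronous, each round the change happens first and then each node sends a message to each neighbor (bandwidth arbitrary); nodes detect changes only through their neighbor lists. A $T$-round algorithm works under the promise that each change at round $i$ is followed by $T-1$ change-free rounds and must output correctly for $G^i$ by the end of round $i+T-1$. $\textsc{MemList}(H)$: each node $v$ lists all subgraphs isomorphic to $H$ containing $v$. $\textsc{MemDetect}(H)$: each node $v$ outputs whether it belongs to some subgraph isomorphic to $H$. *)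

theory Defs
  imports Main
begin

section \<open>Finite simple graphs\<close>

type_synonym 'a graph = "'a set \<times> 'a set set"

abbreviation verts :: "'a graph \<Rightarrow> 'a set" where "verts \<equiv> fst"
abbreviation edges :: "'a graph \<Rightarrow> 'a set set" where "edges \<equiv> snd"

definition simple_graph :: "'a graph \<Rightarrow> bool" where
  "simple_graph G \<longleftrightarrow> finite (verts G) \<and> (\<forall>e\<in>edges G. e \<subseteq> verts G \<and> card e = 2)"

definition adj :: "'a graph \<Rightarrow> 'a rel" where
  "adj G = {(u, v). {u, v} \<in> edges G}"

definition nbrs :: "'a graph \<Rightarrow> 'a \<Rightarrow> 'a set" where
  "nbrs G v = {u. {u, v} \<in> edges G}"

definition connected_graph :: "'a graph \<Rightarrow> bool" where
  "connected_graph G \<longleftrightarrow>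
     verts G \<noteq> {} \<and> (\<forall>u\<in>verts G. \<forall>v\<in>verts G. (u, v) \<in> (adj G)\<^sup>*)"

text \<open>\<open>(u, v) \<in> adj G ^^ n\<close> says that there is a walk of length \<open>n\<close> from \<open>u\<close> to \<open>v\<close>.
  The distance is unspecified if \<open>u\<close> and \<open>v\<close> lie in different components; it is only used
  for connected graphs.\<close>

definition graph_dist :: "'a graph \<Rightarrow> 'a \<Rightarrow> 'a \<Rightarrow> nat" where
  "graph_dist G u v = (LEAST n. (u, v) \<in> adj G ^^ n)"

definition dist_edge :: "'a graph \<Rightarrow> 'a \<Rightarrow> 'a set \<Rightarrow> nat" where
  "dist_edge G u e = 1 + Min (graph_dist G u ` e)"

definition edge_diam :: "'a graph \<Rightarrow> nat" where
  "edge_diam G = Max ((\<lambda>u. Max (dist_edge G u ` edges G)) ` verts G)"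

definition subgraph :: "'a graph \<Rightarrow> 'a graph \<Rightarrow> bool" where
  "subgraph S G \<longleftrightarrow> simple_graph S \<and> verts S \<subseteq> verts G \<and> edges S \<subseteq> edges G"

definition isomorphic :: "'a graph \<Rightarrow> 'b graph \<Rightarrow> bool" where
  "isomorphic G H \<longleftrightarrow>
     (\<exists>f. bij_betw f (verts G) (verts H) \<and>
          (\<forall>u\<in>verts G. \<forall>v\<in>verts G. {u, v} \<in> edges G \<longleftrightarrow> {f u, f v} \<in> edges H))"


section \<open>Dynamic networks under node insertions\<close>

text \<open>Nodes are identified with their IDs, which are natural numbers. \<open>G i\<close> is the graph after
  the change of round \<open>i \<ge> 1\<close>, and \<open>G 0\<close> is the initial graph.\<close>

definition node_insertion :: "nat graph \<Rightarrow> nat graph \<Rightarrow> bool" where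
  "node_insertion G G' \<longleftrightarrow>
     (\<exists>v S. v \<notin> verts G \<and> S \<subseteq> verts G \<and>
            G' = (insert v (verts G), edges G \<union> {{v, u} | u. u \<in> S}))"

definition insertion_sequence :: "(nat \<Rightarrow> nat graph) \<Rightarrow> bool" where
  "insertion_sequence G \<longleftrightarrow>
     simple_graph (G 0) \<and> (\<forall>i. G (Suc i) = G i \<or> node_insertion (G i) (G (Suc i)))"

definition change_at :: "(nat \<Rightarrow> nat graph) \<Rightarrow> nat \<Rightarrow> bool" where
  "change_at G i \<longleftrightarrow> i \<ge> 1 \<and> G i \<noteq> G (i - 1)"

text \<open>Integer arithmetic avoids truncation of \<open>T - 1\<close> for \<open>T \<le> 0\<close>.\<close>

definition change_promise :: "int \<Rightarrow> (nat \<Rightarrow> nat graph) \<Rightarrow> bool" where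
  "change_promise T G \<longleftrightarrow>
     (\<forall>i j. change_at G i \<and> i < j \<and> int j \<le> int i + T - 1 \<longrightarrow> \<not> change_at G j)"

text \<open>A deterministic distributed algorithm with local states \<open>'s\<close>, messages \<open>'m\<close> and outputs
  \<open>'o\<close>. All functions are arbitrary: local computation and message size are unbounded.
  \<^item> \<open>init G0 v\<close>: state in which the node with ID \<open>v\<close> starts, given the initial graph \<open>G0\<close>;
  \<^item> \<open>send s N u\<close>: message sent to neighbour \<open>u\<close> in state \<open>s\<close> with current neighbour list \<open>N\<close>;
  \<^item> \<open>recv s N inbox\<close>: new state, where \<open>inbox u\<close> is the message received from \<open>u\<close>
    (\<open>None\<close> if \<open>u \<notin> N\<close>);
  \<^item> \<open>out s\<close>: output in state \<open>s\<close>.\<close>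

record ('s, 'm, 'o) algorithm =
  init :: "nat graph \<Rightarrow> nat \<Rightarrow> 's"
  send :: "'s \<Rightarrow> nat set \<Rightarrow> nat \<Rightarrow> 'm"
  recv :: "'s \<Rightarrow> nat set \<Rightarrow> (nat \<Rightarrow> 'm option) \<Rightarrow> 's"
  out :: "'s \<Rightarrow> 'o"

text \<open>\<open>state A G i v\<close> is the state of \<open>v\<close> at the end of round \<open>i\<close>. A node that has not been
  inserted yet stays in its starting state, and takes its first step in the round of its
  insertion.\<close>

primrec state :: "('s, 'm, 'o) algorithm \<Rightarrow> (nat \<Rightarrow> nat graph) \<Rightarrow> nat \<Rightarrow> nat \<Rightarrow> 's" where
  "state A G 0 = init A (G 0)"
| "state A G (Suc i) = (\<lambda>v.
     if v \<in> verts (G (Suc i))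
     then recv A (state A G i v) (nbrs (G (Suc i)) v)
            (\<lambda>u. if u \<in> nbrs (G (Suc i)) v
                 then Some (send A (state A G i u) (nbrs (G (Suc i)) u) v)
                 else None)
     else state A G i v)"

definition node_output :: "('s, 'm, 'o) algorithm \<Rightarrow> (nat \<Rightarrow> nat graph) \<Rightarrow> nat \<Rightarrow> nat \<Rightarrow> 'o" where
  "node_output A G t v = out A (state A G t v)"

text \<open>A problem prescribes the output of every node of a graph. For \<open>T \<le> 0\<close> the deadline
  \<open>i + T - 1\<close> lies before the change; nothing is required if it is negative.\<close>

definition round_algorithm ::
  "int \<Rightarrow> (nat graph \<Rightarrow> nat \<Rightarrow> 'o) \<Rightarrow> ('s, 'm, 'o) algorithm \<Rightarrow> bool" where
  "round_algorithm T P A \<longleftrightarrow>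
     (\<forall>G. insertion_sequence G \<and> change_promise T G \<longrightarrow>
        (\<forall>i t. change_at G i \<and> int t = int i + T - 1 \<longrightarrow>
           (\<forall>v\<in>verts (G i). node_output A G t v = P (G i) v)))"


section \<open>Membership problems\<close>

definition mem_list :: "'a graph \<Rightarrow> nat graph \<Rightarrow> nat \<Rightarrow> nat graph set" where
  "mem_list H G v = {S. subgraph S G \<and> isomorphic S H \<and> v \<in> verts S}"

definition mem_detect :: "'a graph \<Rightarrow> nat graph \<Rightarrow> nat \<Rightarrow> bool" where
  "mem_detect H G v \<longleftrightarrow> (\<exists>S. subgraph S G \<and> isomorphic S H \<and> v \<in> verts S)"

end

theory Submission
  imports Defs
begin

text \<open>Let \<open>u\<close> and \<open>e = {v, w}\<close> realise the edge diameter. Insert \<open>v\<close> into \<open>H - v\<close>,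
  once with all its edges and once without \<open>e\<close>. The first run ends in \<open>H\<close>, so \<open>u\<close> must report
  a copy; the second ends in a graph with too few edges to contain one. The two runs differ only at
  \<open>v\<close> and \<open>w\<close>, both at distance at least \<open>edge_diam H - 1\<close> from \<open>u\<close>, and the insertion is already
  visible in the messages of its own round, so \<open>u\<close> cannot distinguish the runs earlier than
  \<open>edge_diam H - 2\<close> rounds after the insertion.\<close>

section \<open>Graphs\<close>

lemma simple_graph_edgeE:
  assumes "simple_graph G" "e \<in> edges G"
  obtains x y where "e = {x, y}" "x \<noteq> y" "x \<in> verts G" "y \<in> verts G"
  using assms unfolding simple_graph_def by (auto simp: card_2_iff)

lemma finite_edges:
  assumes "simple_graph G"
  shows "finite (edges G)"
  using assms by (intro finite_subset[of "edges G" "Pow (verts G)"]) (auto simp: simple_graph_def)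

text \<open>Append the edge to a shortest walk. Reachability of \<open>a\<close> is what makes the
  \<open>LEAST\<close> in \<open>graph_dist G u a\<close> the length of an actual walk.\<close>

lemma graph_dist_step:
  assumes "(u, a) \<in> (adj G)\<^sup>*" "{a, b} \<in> edges G"
  shows "graph_dist G u b \<le> Suc (graph_dist G u a)"
proof -
  have "(u, a) \<in> adj G ^^ graph_dist G u a"
    unfolding graph_dist_def using rtrancl_imp_relpow[OF assms(1)] by (metis LeastI)
  moreover have "(a, b) \<in> adj G"
    using assms(2) by (simp add: adj_def)
  ultimately have "(u, b) \<in> adj G ^^ Suc (graph_dist G u a)"
    by auto
  then show ?thesis
    unfolding graph_dist_def[of G u b] by (rule Least_le)
qed

lemma graph_dist_self [simp]: "graph_dist G u u = 0"
  unfolding graph_dist_def by (rule Least_eq_0) simp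

lemma connected_graph_has_edge:
  assumes "connected_graph G" "card (verts G) \<ge> 2"
  shows "edges G \<noteq> {}"
proof -
  obtain B where "B \<subseteq> verts G" "card B = 2"
    using obtain_subset_with_card_n[OF assms(2)] by metis
  then obtain a b where "a \<in> verts G" "b \<in> verts G" "a \<noteq> b"
    by (auto simp: card_2_iff)
  then have "(a, b) \<in> (adj G)\<^sup>*" "a \<noteq> b"
    using assms(1) by (auto simp: connected_graph_def)
  then obtain c where "(a, c) \<in> adj G"
    by (meson converse_rtranclE)
  then show ?thesis
    by (auto simp: adj_def)
qed

lemma edge_diam_attained:
  assumes "simple_graph G" "verts G \<noteq> {}" "edges G \<noteq> {}"
  obtains u e where "u \<in> verts G" "e \<in> edges G" "dist_edge G u e = edge_diam G"
proof -
  have "edge_diam G \<in> (\<lambda>u. Max (dist_edge G u ` edges G)) ` verts G"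
    unfolding edge_diam_def using assms by (intro Max_in) (auto simp: simple_graph_def)
  then obtain u where u: "u \<in> verts G" "edge_diam G = Max (dist_edge G u ` edges G)"
    by auto
  have "Max (dist_edge G u ` edges G) \<in> dist_edge G u ` edges G"
    using assms(3) finite_edges[OF assms(1)] by (intro Max_in) auto
  with u that show ?thesis
    by auto
qed

text \<open>Edges are sets of vertices, so taking images under an injective vertex map is injective
  on edges; every edge of \<open>H\<close> is hit since it has the form
  \<open>{f x, f y}\<close>.\<close>

lemma isomorphic_card_edges:
  assumes G: "simple_graph G" and H: "simple_graph H" and "isomorphic G H"
  shows "card (edges G) = card (edges H)"
proof -
  obtain f where f: "bij_betw f (verts G) (verts H)"
    and adj: "\<And>u v. u \<in> verts G \<Longrightarrow> v \<in> verts G \<Longrightarrow> {u, v} \<in> edges G \<longleftrightarrow> {f u, f v} \<in> edges H"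
    using assms(3) by (auto simp: isomorphic_def)
  have "inj_on (image f) (edges G)"
    using G f by (intro inj_on_subset[OF inj_on_image_Pow[of f "verts G"]])
      (auto simp: simple_graph_def bij_betw_def)
  moreover have "image f ` edges G = edges H"
  proof (intro equalityI subsetI)
    fix e assume "e \<in> image f ` edges G"
    then obtain x where x: "x \<in> edges G" "e = f ` x"
      by auto
    then show "e \<in> edges H"
      using adj simple_graph_edgeE[OF G x(1)] by (metis image_empty image_insert)
  next
    fix e assume "e \<in> edges H"
    then obtain a b where ab: "e = {a, b}" "a \<in> verts H" "b \<in> verts H"
      by (rule simple_graph_edgeE[OF H])
    then obtain x y where xy: "x \<in> verts G" "y \<in> verts G" "a = f x" "b = f y"
      using bij_betw_imp_surj_on[OF f] by blast
    then have "{x, y} \<in> edges G" "e = f ` {x, y}"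
      using adj ab \<open>e \<in> edges H\<close> by auto
    then show "e \<in> image f ` edges G"
      by blast
  qed
  ultimately show ?thesis
    by (metis card_image)
qed

text \<open>Network nodes are natural numbers while \<open>H\<close> has an arbitrary vertex type;
  this relabelling provides a copy of \<open>H\<close> on IDs.\<close>

definition map_graph :: "('a \<Rightarrow> 'b) \<Rightarrow> 'a graph \<Rightarrow> 'b graph" where
  "map_graph f G = (f ` verts G, image f ` edges G)"

lemma simple_map_graph:
  assumes "simple_graph G" "inj_on f (verts G)"
  shows "simple_graph (map_graph f G)"
  using assms unfolding simple_graph_def map_graph_def
  by (auto simp: card_image inj_on_subset)

lemma edge_map_graph_iff:
  assumes "simple_graph G" "inj_on f (verts G)" "a \<in> verts G" "b \<in> verts G"
  shows "{f a, f b} \<in> edges (map_graph f G) \<longleftrightarrow> {a, b} \<in> edges G"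
proof -
  have "f ` {a, b} \<in> image f ` edges G \<longleftrightarrow> {a, b} \<in> edges G"
    using assms by (intro inj_on_image_mem_iff[OF inj_on_image_Pow]) (auto simp: simple_graph_def)
  then show ?thesis
    by (simp add: map_graph_def)
qed

lemma isomorphic_map_graph:
  assumes "simple_graph G" "inj_on f (verts G)"
  shows "isomorphic (map_graph f G) G"
  unfolding isomorphic_def
proof (intro exI conjI ballI)
  show "bij_betw (inv_into (verts G) f) (verts (map_graph f G)) (verts G)"
    using assms by (simp add: map_graph_def bij_betw_inv_into inj_on_imp_bij_betw)
  show "{x, y} \<in> edges (map_graph f G) \<longleftrightarrow>
      {inv_into (verts G) f x, inv_into (verts G) f y} \<in> edges G"
    if "x \<in> verts (map_graph f G)" "y \<in> verts (map_graph f G)" for x y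
  proof -
    obtain a b where "x = f a" "y = f b" "a \<in> verts G" "b \<in> verts G"
      using \<open>x \<in> _\<close> \<open>y \<in> _\<close> by (auto simp: map_graph_def)
    then show ?thesis
      using edge_map_graph_iff[OF assms] assms(2) by simp
  qed
qed

definition delete_vertex :: "'a graph \<Rightarrow> 'a \<Rightarrow> 'a graph" where
  "delete_vertex G v = (verts G - {v}, {e \<in> edges G. v \<notin> e})"

definition delete_edge :: "'a graph \<Rightarrow> 'a set \<Rightarrow> 'a graph" where
  "delete_edge G e = (verts G, edges G - {e})"

lemma simple_delete_vertex: "simple_graph G \<Longrightarrow> simple_graph (delete_vertex G v)"
  by (auto simp: simple_graph_def delete_vertex_def)

lemma simple_delete_edge: "simple_graph G \<Longrightarrow> simple_graph (delete_edge G e)"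
  by (auto simp: simple_graph_def delete_edge_def)

lemma delete_vertex_delete_edge:
  "v \<in> e \<Longrightarrow> delete_vertex (delete_edge G e) v = delete_vertex G v"
  by (auto simp: delete_vertex_def delete_edge_def)

text \<open>Pure counting: a copy needs \<open>card (edges H)\<close> edges, and after the deletion
  fewer remain.\<close>

lemma no_copy_in_delete_edge:
  assumes "simple_graph G" "simple_graph H" "e \<in> edges G"
    and "card (edges G) \<le> card (edges H)"
  shows "\<not> (subgraph S (delete_edge G e) \<and> isomorphic S H)"
proof
  assume S: "subgraph S (delete_edge G e) \<and> isomorphic S H"
  then have "card (edges S) = card (edges H)"
    by (intro isomorphic_card_edges assms(2)) (simp_all add: subgraph_def)
  moreover have "card (edges S) < card (edges G)"
    using S assms(3) finite_edges[OF assms(1)]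
    by (intro psubset_card_mono) (auto simp: subgraph_def delete_edge_def)
  ultimately show False
    using assms(4) by simp
qed

section \<open>Inserting a single vertex\<close>

text \<open>The inserted vertex is joined to its old neighbourhood. Absence of loops keeps
  \<open>v\<close> out of that set.\<close>

lemma node_insertion_delete_vertex:
  fixes G :: "nat graph"
  assumes G: "simple_graph G" and v: "v \<in> verts G"
  shows "node_insertion (delete_vertex G v) G"
proof -
  define S where "S = {u. {v, u} \<in> edges G}"
  have "S \<subseteq> verts G - {v}"
    using G by (fastforce simp: S_def simple_graph_def)
  moreover have "edges G = {e \<in> edges G. v \<notin> e} \<union> {{v, u} | u. u \<in> S}"
  proof (intro equalityI subsetI)
    fix e assume e: "e \<in> edges G"
    obtain x y where "e = {x, y}"
      using simple_graph_edgeE[OF G e] by blast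
    with e show "e \<in> {e \<in> edges G. v \<notin> e} \<union> {{v, u} | u. u \<in> S}"
      unfolding S_def by (cases "v \<in> e") (auto simp: insert_commute)
  qed (auto simp: S_def)
  moreover have "insert v (verts G - {v}) = verts G"
    using v by auto
  ultimately show ?thesis
    unfolding node_insertion_def delete_vertex_def
    by (intro exI[of _ v] exI[of _ S]) (simp add: prod_eq_iff)
qed

definition insertion_run :: "nat \<Rightarrow> nat graph \<Rightarrow> nat \<Rightarrow> nat \<Rightarrow> nat graph" where
  "insertion_run i G v j = (if j < i then delete_vertex G v else G)"

lemma insertion_run:
  assumes "simple_graph G" "v \<in> verts G" "i \<ge> 1"
  shows "insertion_sequence (insertion_run i G v)"
    and "change_promise T (insertion_run i G v)"
    and "change_at (insertion_run i G v) i"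
proof -
  show "insertion_sequence (insertion_run i G v)"
    using assms node_insertion_delete_vertex
    by (auto simp: insertion_sequence_def insertion_run_def simple_delete_vertex)
  \<comment> \<open>Round \<open>i\<close> is the only possible change, so the promise holds for
    every \<open>T\<close>.\<close>
  show "change_promise T (insertion_run i G v)"
    by (auto simp: change_promise_def change_at_def insertion_run_def split: if_splits)
  show "change_at (insertion_run i G v) i"
    using assms by (auto simp: change_at_def insertion_run_def delete_vertex_def prod_eq_iff)
qed

text \<open>The Lipschitz function \<open>c\<close> plays the role of the distance from the observing node, and \<open>B\<close> is
  the set of nodes whose neighbourhoods differ between the two runs.\<close>

lemma state_eq_away_from_difference:
  fixes c :: "nat \<Rightarrow> nat"
  assumes before: "\<And>j. j < i \<Longrightarrow> G j = G' j"
    and verts: "\<And>j. verts (G j) = verts (G' j)"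
    and nbrs: "\<And>j x. x \<notin> B \<Longrightarrow> nbrs (G j) x = nbrs (G' j) x"
    and far: "\<And>x. x \<in> B \<Longrightarrow> m \<le> c x"
    and lipschitz: "\<And>j x y. y \<in> nbrs (G j) x \<Longrightarrow> c y \<le> Suc (c x)"
    and "i \<ge> 1" and "t < i \<or> c x + t + 2 \<le> i + m"
  shows "state A G t x = state A G' t x"
  using assms(7)
proof (induction t arbitrary: x)
  case 0
  then show ?case
    using before \<open>i \<ge> 1\<close> by simp
next
  case (Suc t)
  show ?case
  proof (cases "Suc t < i")
    case True
    then show ?thesis
      using Suc.IH before[of "Suc t"] by (simp cong: if_cong)
  next
    case False
    with Suc.prems have c: "c x + t + 3 \<le> i + m"
      by simp
    \<comment> \<open>Here \<open>i \<le> Suc t\<close>, so \<open>c\<close> gives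
      \<open>c x + 2 \<le> m\<close>. This leaves room for one more step: neighbours of
      \<open>x\<close> also stay outside \<open>B\<close>, which matters because their messages
      depend on their own current neighbour lists.\<close>
    have x: "x \<notin> B"
      using False c far by fastforce
    have y: "state A G t y = state A G' t y" "nbrs (G (Suc t)) y = nbrs (G' (Suc t)) y"
      if "y \<in> nbrs (G (Suc t)) x" for y
    proof -
      have "c y \<le> Suc (c x)"
        using lipschitz that by blast
      then have "y \<notin> B" "t < i \<or> c y + t + 2 \<le> i + m"
        using False c far by fastforce+
      then show "state A G t y = state A G' t y" "nbrs (G (Suc t)) y = nbrs (G' (Suc t)) y"
        using Suc.IH nbrs by blast+
    qed
    have "state A G t x = state A G' t x"
      using Suc.IH c by simp
    moreover have "(\<lambda>u. if u \<in> nbrs (G (Suc t)) x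
          then Some (send A (state A G t u) (nbrs (G (Suc t)) u) x) else None) =
        (\<lambda>u. if u \<in> nbrs (G' (Suc t)) x
          then Some (send A (state A G' t u) (nbrs (G' (Suc t)) u) x) else None)"
      using y nbrs[OF x] by (intro ext) metis
    ultimately show ?thesis
      using nbrs[OF x] verts by simp
  qed
qed

section \<open>The lower bound\<close>

text \<open>Listing and detection are treated together: the argument uses only that deleting an edge
  from a copy of \<open>H\<close> changes the required output at every node.\<close>

lemma no_round_algorithm:
  fixes H :: "'a graph" and A :: "('s, 'm, 'o) algorithm"
  assumes H: "simple_graph H" "connected_graph H" "card (verts H) \<ge> 2"
    and T: "T < int (edge_diam H) - 1"
    and P: "\<And>K e x. simple_graph K \<Longrightarrow> isomorphic K H \<Longrightarrow> e \<in> edges K \<Longrightarrow> x \<in> verts K \<Longrightarrow>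
      P K x \<noteq> P (delete_edge K e) x"
  shows "\<not> round_algorithm T P A"
proof
  assume A: "round_algorithm T P A"
  obtain u e where u: "u \<in> verts H" and e: "e \<in> edges H" and ue: "dist_edge H u e = edge_diam H"
    using edge_diam_attained H connected_graph_has_edge by (metis connected_graph_def)
  obtain v w where vw: "e = {v, w}" "v \<in> verts H" "w \<in> verts H"
    using simple_graph_edgeE[OF H(1) e] by metis
  obtain f :: "'a \<Rightarrow> nat" where f: "inj_on f (verts H)"
    using H(1) finite_imp_inj_to_nat_seg unfolding simple_graph_def by metis
  define K where "K = map_graph f H"
  define K' where "K' = delete_edge K {f v, f w}"
  have K: "simple_graph K" "isomorphic K H"
    using H(1) f by (simp_all add: K_def simple_map_graph isomorphic_map_graph)
  have K': "simple_graph K'"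
    using K by (simp add: K'_def simple_delete_edge)
  have in_K: "f u \<in> verts K" "f v \<in> verts K" "{f v, f w} \<in> edges K"
    using u vw e edge_map_graph_iff[OF H(1) f vw(2,3)]
    by (simp_all add: K_def) (simp_all add: map_graph_def)
  have verts_K': "verts K' = verts K"
    by (simp add: K'_def delete_edge_def)

  \<comment> \<open>This choice makes the deadline \<open>i + T - 1 = \<bar>T\<bar> + T\<close>
    nonnegative even for negative \<open>T\<close>, so that the algorithm is bound by it.\<close>
  define i where "i = Suc (nat \<bar>T\<bar>)"
  define t where "t = nat (int i + T - 1)"
  have t: "int t = int i + T - 1" "i \<ge> 1"
    by (auto simp: t_def i_def)
  define G where "G = insertion_run i K (f v)"
  define G' where "G' = insertion_run i K' (f v)"
  have "node_output A G t (f u) = P (G i) (f u)"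
    using A insertion_run[OF K(1) in_K(2) t(2)] t in_K
    by (auto simp: round_algorithm_def G_def insertion_run_def)
  moreover have "node_output A G' t (f u) = P (G' i) (f u)"
    using A insertion_run[OF K' _ t(2), of "f v"] t in_K verts_K'
    by (auto simp: round_algorithm_def G'_def insertion_run_def)
  moreover have "P (G i) (f u) \<noteq> P (G' i) (f u)"
    using P K in_K by (simp add: G_def G'_def insertion_run_def K'_def)
  moreover have "state A G t (f u) = state A G' t (f u)"
  proof (rule state_eq_away_from_difference)
    \<comment> \<open>Distance from \<open>u\<close> in the full graph \<open>H\<close>, pulled back
      along the relabelling. Every graph of the run has only edges of \<open>K\<close>, so it is
      Lipschitz in every round.\<close>
    let ?c = "\<lambda>x. graph_dist H u (inv_into (verts H) f x)"
    \<comment> \<open>The deleted edge contains the inserted vertex \<open>f v\<close>, so the runs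
      agree until round \<open>i\<close>.\<close>
    show "G j = G' j" if "j < i" for j
      using that by (simp add: G_def G'_def insertion_run_def K'_def delete_vertex_delete_edge)
    show "verts (G j) = verts (G' j)" for j
      by (simp add: G_def G'_def insertion_run_def delete_vertex_def verts_K')
    show "nbrs (G j) x = nbrs (G' j) x" if "x \<notin> {f v, f w}" for j x
      using that by (auto simp: G_def G'_def insertion_run_def K'_def delete_vertex_def
          delete_edge_def nbrs_def doubleton_eq_iff)
    \<comment> \<open>\<open>dist_edge\<close> is one plus the minimum over the two ends, so both
      ends obey the bound.\<close>
    show "edge_diam H - 1 \<le> ?c x" if "x \<in> {f v, f w}" for x
      using that ue vw f by (auto simp: dist_edge_def)
    show "?c y \<le> Suc (?c x)" if "y \<in> nbrs (G j) x" for j x y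
    proof -
      have xy: "{x, y} \<in> edges K"
        using that by (auto simp: nbrs_def G_def insertion_run_def delete_vertex_def
            insert_commute split: if_splits)
      then have "x \<in> verts K" "y \<in> verts K"
        using K(1) by (auto simp: simple_graph_def)
      then obtain a b where ab: "x = f a" "y = f b" "a \<in> verts H" "b \<in> verts H"
        by (auto simp: K_def map_graph_def)
      then have "{a, b} \<in> edges H"
        using xy edge_map_graph_iff[OF H(1) f] by (simp add: K_def)
      then show ?thesis
        using ab graph_dist_step[of u a H b] H(2) u f by (auto simp: connected_graph_def)
    qed
    show "i \<ge> 1"
      by (fact t)
    \<comment> \<open>For \<open>T \<le> 0\<close> the deadline precedes round \<open>i\<close>.
      Otherwise \<open>?c (f u) = 0\<close>, and \<open>T \<le> edge_diam H - 2\<close> gives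
      \<open>t + 2 = i + T + 1 \<le> i + (edge_diam H - 1)\<close>.\<close>
    show "t < i \<or> ?c (f u) + t + 2 \<le> i + (edge_diam H - 1)"
      using t T u f by simp linarith
  qed
  ultimately show False
    by (simp add: node_output_def)
qed

text \<open>\<open>K\<close> serves as its own copy of \<open>H\<close>; the edge count excludes
  every copy after the deletion.\<close>

lemma copy_difference:
  fixes K :: "nat graph"
  assumes "simple_graph H" "simple_graph K" "isomorphic K H" "e \<in> edges K" "x \<in> verts K"
  shows "K \<in> mem_list H K x" and "mem_list H (delete_edge K e) x = {}"
proof -
  show "K \<in> mem_list H K x"
    using assms by (auto simp: mem_list_def subgraph_def)
  show "mem_list H (delete_edge K e) x = {}"
    using no_copy_in_delete_edge[OF assms(2,1,4)] isomorphic_card_edges[OF assms(2,1,3)]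
    by (auto simp: mem_list_def)
qed

lemma mem_detect_iff_mem_list: "mem_detect H G x \<longleftrightarrow> mem_list H G x \<noteq> {}"
  by (auto simp: mem_detect_def mem_list_def)

theorem theorem2p14:
  fixes H :: "'a graph" and r\<^sub>H T :: int
  assumes "simple_graph H" and "connected_graph H" and "card (verts H) \<ge> 3"
    and "r\<^sub>H = int (edge_diam H) - 1"
    and "T < r\<^sub>H"
  shows "\<not> (\<exists>A :: ('s, 'm, nat graph set) algorithm. round_algorithm T (mem_list H) A) \<and>
         \<not> (\<exists>A :: ('t, 'n, bool) algorithm. round_algorithm T (mem_detect H) A)"
proof -
  \<comment> \<open>The listed sets differ as nonempty against empty, which detection sees as
    well.\<close>
  have 1: "mem_list H K x \<noteq> mem_list H (delete_edge K e) x"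
    and 2: "mem_detect H K x \<noteq> mem_detect H (delete_edge K e) x"
    if "simple_graph K" "isomorphic K H" "e \<in> edges K" "x \<in> verts K" for K e x
    using copy_difference[OF assms(1) that] by (auto simp: mem_detect_iff_mem_list)
  have "card (verts H) \<ge> 2" "T < int (edge_diam H) - 1"
    using assms by simp_all
  note lower_bound = no_round_algorithm[OF assms(1,2) this]
  show ?thesis
    using lower_bound[of "mem_list H", OF 1] lower_bound[of "mem_detect H", OF 2] by blast
qed

end
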